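(* Let $G$ be a reduced graph. Then every shallow terminal in $G$ is simplicial in $G$; that is, whenever an induced subgraph $W$ of $G$ is a $\dagger$-AW $(s:c:l,B,r)$ or a $\ddagger$-AW $(s:c_1,c_2:l,B,r)$, the neighborhood $N_G(s)$ of its shallow terminal $s$ in $G$ induces a clique.
   Context: Graphs are finite, simple, undirected. A set $X\subseteq V(G)$ is a minimal forbidden set if $G[X]$ is not an interval graph but $G[X']$ is an interval graph for every proper subset $X'\subset X$. A graph is prereduced if it has no minimal forbidden set of at most $10$ vertices. A module is a set $M\subseteq V(G)$ such that every vertex of $M$ has the same neighbors outside $M$; it is nontrivial if $1<|M|<|V(G)|$. A graph is reduced if it is prereduced and every nontrivial module induces a clique. A $\dagger$-AW $(s:c:l,B,r)$ with $B=\{b_1,\dots,b_d\}$, $d\ge 3$, writing $b_0=l$, $b_{d+1}=r$, is the graph on vertices $s,c,b_0,\dots,b_{d+1}$ whose edges are exactly $b_ib_{i+1}$ ($0\le i\le d$), $cs$, and $cb_i$ ($1\le i\le d$). A $\ddagger$-AW $(s:c_1,c_2:l,B,r)$ with $B=\{b_1,\dots,b_d\}$, $d\ge 2$, $b_0=l$, $b_{d+1}=r$, is the graph on $s,c_1,c_2,b_0,\dots,b_{d+1}$ whose edges are exactly $b_ib_{i+1}$ ($0\le i\le d$), $c_1c_2$, $c_1s$, $c_2s$, $c_1l$, $c_2r$, and $c_jb_i$ for $j=1,2$ and $1\le i\le d$. In such a graph, $s$ is the shallow terminal, $l,r$ the base terminals, $c$ (resp. $c_1,c_2$) the center(s), and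 $B$ the base. A vertex is simplicial if its neighborhood induces a clique. *)

theory Defs
  imports Complex_Main "Graph_Theory.Graph_Theory"
begin

text \<open>A finite simple undirected graph is a digraph satisfying \<open>graph\<close> from \<open>Graph_Theory\<close>:
  finite, loop-free, without parallel arcs, and symmetric, so that
  \<open>u \<rightarrow>\<^bsub>G\<^esub> v\<close> expresses adjacency.\<close>

definition interval_graph :: "('a,'b) pre_digraph \<Rightarrow> bool" where
  "interval_graph G \<longleftrightarrow>
    (\<exists>lo hi :: 'a \<Rightarrow> real.
      (\<forall>v\<in>verts G. lo v \<le> hi v) \<and>
      (\<forall>u\<in>verts G. \<forall>v\<in>verts G. u \<noteq> v \<longrightarrow>
        (u \<rightarrow>\<^bsub>G\<^esub> v \<longleftrightarrow> {lo u..hi u} \<inter> {lo v..hi v} \<noteq> {})))"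

definition minimal_forbidden_set :: "('a,'b) pre_digraph \<Rightarrow> 'a set \<Rightarrow> bool" where
  "minimal_forbidden_set G X \<longleftrightarrow>
    X \<subseteq> verts G \<and> \<not> interval_graph (G \<restriction> X) \<and> (\<forall>X'. X' \<subset> X \<longrightarrow> interval_graph (G \<restriction> X'))"

definition prereduced :: "('a,'b) pre_digraph \<Rightarrow> bool" where
  "prereduced G \<longleftrightarrow> \<not> (\<exists>X. minimal_forbidden_set G X \<and> card X \<le> 10)"

definition neighborhood :: "('a,'b) pre_digraph \<Rightarrow> 'a \<Rightarrow> 'a set" where
  "neighborhood G v = {u \<in> verts G. v \<rightarrow>\<^bsub>G\<^esub> u}"

definition induces_clique :: "('a,'b) pre_digraph \<Rightarrow> 'a set \<Rightarrow> bool" where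
  "induces_clique G K \<longleftrightarrow> (\<forall>u\<in>K. \<forall>v\<in>K. u \<noteq> v \<longrightarrow> u \<rightarrow>\<^bsub>G\<^esub> v)"

definition graph_module :: "('a,'b) pre_digraph \<Rightarrow> 'a set \<Rightarrow> bool" where
  "graph_module G M \<longleftrightarrow>
    M \<subseteq> verts G \<and> (\<forall>u\<in>M. \<forall>v\<in>M. neighborhood G u - M = neighborhood G v - M)"

definition nontrivial_module :: "('a,'b) pre_digraph \<Rightarrow> 'a set \<Rightarrow> bool" where
  "nontrivial_module G M \<longleftrightarrow> graph_module G M \<and> 1 < card M \<and> card M < card (verts G)"

definition reduced :: "('a,'b) pre_digraph \<Rightarrow> bool" where
  "reduced G \<longleftrightarrow> prereduced G \<and> (\<forall>M. nontrivial_module G M \<longrightarrow> induces_clique G M)"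

definition simplicial :: "('a,'b) pre_digraph \<Rightarrow> 'a \<Rightarrow> bool" where
  "simplicial G v \<longleftrightarrow> v \<in> verts G \<and> induces_clique G (neighborhood G v)"

text \<open>\<open>has_edges W E\<close>: the (undirected) edge set of \<open>W\<close> is exactly \<open>E\<close>.\<close>

definition has_edges :: "('a,'b) pre_digraph \<Rightarrow> 'a set set \<Rightarrow> bool" where
  "has_edges W E \<longleftrightarrow> (\<forall>u v. u \<rightarrow>\<^bsub>W\<^esub> v \<longleftrightarrow> {u, v} \<in> E)"

text \<open>The base is given as the list \<open>B = [b\<^sub>1, \<dots>, b\<^sub>d]\<close>; thus \<open>(l # B @ [r]) ! i\<close> is \<open>b\<^sub>i\<close>
  for \<open>0 \<le> i \<le> d + 1\<close>.\<close>

definition dagger_AW ::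
    "('a,'b) pre_digraph \<Rightarrow> 'a \<Rightarrow> 'a \<Rightarrow> 'a \<Rightarrow> 'a list \<Rightarrow> 'a \<Rightarrow> bool" where
  "dagger_AW W s c l B r \<longleftrightarrow>
    (let d = length B; b = (\<lambda>i. (l # B @ [r]) ! i) in
      3 \<le> d \<and>
      distinct (s # c # l # B @ [r]) \<and>
      verts W = set (s # c # l # B @ [r]) \<and>
      has_edges W
        ({{b i, b (i + 1)} | i. i \<le> d} \<union> {{c, s}} \<union> {{c, b i} | i. 1 \<le> i \<and> i \<le> d}))"

definition ddagger_AW ::
    "('a,'b) pre_digraph \<Rightarrow> 'a \<Rightarrow> 'a \<Rightarrow> 'a \<Rightarrow> 'a \<Rightarrow> 'a list \<Rightarrow> 'a \<Rightarrow> bool" where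
  "ddagger_AW W s c\<^sub>1 c\<^sub>2 l B r \<longleftrightarrow>
    (let d = length B; b = (\<lambda>i. (l # B @ [r]) ! i) in
      2 \<le> d \<and>
      distinct (s # c\<^sub>1 # c\<^sub>2 # l # B @ [r]) \<and>
      verts W = set (s # c\<^sub>1 # c\<^sub>2 # l # B @ [r]) \<and>
      has_edges W
        ({{b i, b (i + 1)} | i. i \<le> d} \<union>
         {{c\<^sub>1, c\<^sub>2}, {c\<^sub>1, s}, {c\<^sub>2, s}, {c\<^sub>1, l}, {c\<^sub>2, r}} \<union>
         {{c, b i} | c i. c \<in> {c\<^sub>1, c\<^sub>2} \<and> 1 \<le> i \<and> i \<le> d}))"

definition shallow_terminal :: "('a,'b) pre_digraph \<Rightarrow> 'a \<Rightarrow> bool" where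
  "shallow_terminal G s \<longleftrightarrow>
    (\<exists>X\<subseteq>verts G.
      (\<exists>c l B r. dagger_AW (G \<restriction> X) s c l B r) \<or>
      (\<exists>c\<^sub>1 c\<^sub>2 l B r. ddagger_AW (G \<restriction> X) s c\<^sub>1 c\<^sub>2 l B r))"

end

theory Submission
  imports Defs
begin

text \<open>Among all witnesses with shallow terminal \<open>s\<close>, take one with a shortest base \<open>B\<close>. Excluding
  chordless cycles of length 4 and 5 and asteroidal triples on at most ten vertices shows that a
  neighbour of \<open>s\<close> is adjacent to all of \<open>B\<close> or to none of it: otherwise it could serve as a center
  of a shorter witness. A neighbour \<open>v\<close> of \<open>s\<close> without neighbours in \<open>B\<close> can replace \<open>s\<close> in the
  witness, and every common neighbour of \<open>B\<close> is adjacent to every possible shallow terminal for \<open>B\<close>.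
  Hence the component \<open>M\<close> of \<open>s\<close> in the graph induced by the vertices without neighbours in \<open>B\<close> is
  a module, whose outer neighbourhood is the set \<open>C\<close> of common neighbours of \<open>B\<close>. Both \<open>M\<close> (as the
  graph is reduced) and \<open>C\<close> (by the absence of chordless 4-cycles) are cliques, and
  the neighbourhood of \<open>s\<close> lies in \<open>M \<union> C\<close>.\<close>

section \<open>Asteroidal triples in interval models\<close>

text \<open>The avoided vertex \<open>a\<close> comes first: \<open>p\<close> misses its closed
  neighbourhood. Three such walks, one for each avoided vertex, witness an asteroidal triple. Walks
  may repeat vertices, so no distinctness has to be checked.\<close>

definition walk_avoiding :: "('a \<Rightarrow> 'a \<Rightarrow> bool) \<Rightarrow> 'a \<Rightarrow> 'a \<Rightarrow> 'a \<Rightarrow> 'a list \<Rightarrow> bool" where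
  "walk_avoiding E a b c p \<longleftrightarrow>
    p \<noteq> [] \<and> hd p = b \<and> last p = c \<and> successively E p \<and> (\<forall>y\<in>set p. y \<noteq> a \<and> \<not> E a y)"

lemma walk_avoiding_ends:
  assumes "walk_avoiding E a b c p"
  shows "b \<in> set p" "c \<in> set p" "a \<noteq> b" "a \<noteq> c" "\<not> E a b" "\<not> E a c"
proof -
  show "b \<in> set p" "c \<in> set p"
    using assms hd_in_set[of p] last_in_set[of p] unfolding walk_avoiding_def by blast+
  then show "a \<noteq> b" "a \<noteq> c" "\<not> E a b" "\<not> E a c"
    using assms unfolding walk_avoiding_def by blast+
qed

definition interval_model :: "('a \<Rightarrow> 'a \<Rightarrow> bool) \<Rightarrow> 'a set \<Rightarrow> ('a \<Rightarrow> real) \<Rightarrow> ('a \<Rightarrow> real) \<Rightarrow> bool" where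
  "interval_model E X lo hi \<longleftrightarrow>
    (\<forall>v\<in>X. lo v \<le> hi v) \<and>
    (\<forall>u\<in>X. \<forall>v\<in>X. u \<noteq> v \<longrightarrow> (E u v \<longleftrightarrow> lo u \<le> hi v \<and> lo v \<le> hi u))"

text \<open>Consecutive intervals meet while none meets that of \<open>a\<close>, so the walk cannot
  jump across \<open>a\<close>.\<close>

lemma interval_model_walk_side:
  assumes "interval_model E X lo hi" "successively E p" "p \<noteq> []" "set p \<subseteq> X" "a \<in> X"
    and "\<forall>y\<in>set p. y \<noteq> a \<and> \<not> E a y"
  shows "hi (hd p) < lo a \<longleftrightarrow> hi (last p) < lo a"
  using assms(2-4,6)
proof (induction p rule: induct_list012)
  case (3 x y zs)
  have *: "lo u \<le> hi u" "E u v \<longleftrightarrow> lo u \<le> hi v \<and> lo v \<le> hi u" if "u \<in> X" "v \<in> X" "u \<noteq> v" for u v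
    using assms(1) that by (auto simp: interval_model_def)
  have "lo a \<le> hi a"
    using assms(1,5) by (auto simp: interval_model_def)
  moreover have "x \<noteq> y \<Longrightarrow> lo x \<le> hi y \<and> lo y \<le> hi x"
    using 3 *(2)[of x y] by auto
  moreover have "lo x \<le> hi x" "lo y \<le> hi y" "\<not> (lo a \<le> hi x \<and> lo x \<le> hi a)" "\<not> (lo a \<le> hi y \<and> lo y \<le> hi a)"
    using 3 assms(5) *[of x a] *[of y a] *[of a x] *[of a y] by auto
  ultimately have "hi x < lo a \<longleftrightarrow> hi y < lo a"
    by (cases "x = y") auto
  then show ?case
    using 3 by auto
qed auto

text \<open>The three intervals are pairwise disjoint, so one lies between the other two; yet the
  walk avoiding it keeps those two on the same side.\<close>

lemma interval_model_no_asteroidal_triple: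
  assumes "interval_model E X lo hi" "set p \<subseteq> X" "set q \<subseteq> X" "set r \<subseteq> X"
    and "walk_avoiding E a b c p" "walk_avoiding E b a c q" "walk_avoiding E c a b r"
  shows False
proof -
  note ends = walk_avoiding_ends[OF assms(5)] walk_avoiding_ends[OF assms(6)] walk_avoiding_ends[OF assms(7)]
  then have X: "a \<in> X" "b \<in> X" "c \<in> X"
    using assms(2-4) by blast+
  have "hi b < lo a \<longleftrightarrow> hi c < lo a"
    using interval_model_walk_side[OF assms(1) _ _ assms(2) X(1)] assms(5) by (simp add: walk_avoiding_def)
  moreover have "hi a < lo b \<longleftrightarrow> hi c < lo b"
    using interval_model_walk_side[OF assms(1) _ _ assms(3) X(2)] assms(6) by (simp add: walk_avoiding_def)
  moreover have "hi a < lo c \<longleftrightarrow> hi b < lo c"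
    using interval_model_walk_side[OF assms(1) _ _ assms(4) X(3)] assms(7) by (simp add: walk_avoiding_def)
  moreover have "\<not> (lo a \<le> hi b \<and> lo b \<le> hi a)" "\<not> (lo a \<le> hi c \<and> lo c \<le> hi a)" "\<not> (lo b \<le> hi c \<and> lo c \<le> hi b)"
    using assms(1) X ends unfolding interval_model_def by blast+
  moreover have "lo a \<le> hi a" "lo b \<le> hi b" "lo c \<le> hi c"
    using assms(1) X by (auto simp: interval_model_def)
  ultimately show False
    by linarith
qed

text \<open>In an interval graph, the neighbours of an interval that ends first all contain its end.\<close>

lemma interval_model_first_end:
  assumes "interval_model E X lo hi" "v \<in> X" "u \<in> X" "w \<in> X" "E v u" "E v w" "v \<noteq> u" "v \<noteq> w" "u \<noteq> w"
    and "hi v \<le> hi u" "hi v \<le> hi w"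
  shows "E u w"
proof -
  have "lo u \<le> hi v" "lo w \<le> hi v"
    using assms by (auto simp: interval_model_def)
  then show ?thesis
    using assms by (auto simp: interval_model_def)
qed

section \<open>Graphs that are interval on every ten vertices\<close>

text \<open>Adjacency is a plain relation, which keeps induced subdigraphs out of the combinatorics;
  \<open>small\<close> is prereducedness in the form in which it is applied.\<close>

locale locally_interval =
  fixes V :: "'a set" and E :: "'a \<Rightarrow> 'a \<Rightarrow> bool"
  assumes adj_sym: "E u v \<Longrightarrow> E v u"
    and adj_irrefl: "\<not> E v v"
    and adj_in: "E u v \<Longrightarrow> u \<in> V"
    and small: "X \<subseteq> V \<Longrightarrow> finite X \<Longrightarrow> card X \<le> 10 \<Longrightarrow> \<exists>lo hi. interval_model E X lo hi"
begin

lemma small_list: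
  assumes "set L \<subseteq> V" "length L \<le> 10"
  obtains lo hi where "interval_model E (set L) lo hi"
  using small[of "set L"] assms card_length[of L] by fastforce

lemma adj_commute: "E u v \<longleftrightarrow> E v u"
  using adj_sym by blast

lemma walk_in:
  assumes "successively E p" "p \<noteq> []" "hd p \<noteq> last p"
  shows "set p \<subseteq> V"
proof -
  obtain x y zs where p: "p = x # y # zs"
    using assms(2,3) by (cases p rule: remdups_adj.cases) auto
  have "successively E (x # y # zs) \<Longrightarrow> set (x # y # zs) \<subseteq> V"
    by (induction zs arbitrary: x y) (auto dest: adj_in adj_sym)
  then show ?thesis
    using assms(1) p by blast
qed

text \<open>\<open>L\<close> serves to bound the number of vertices. The walks lie in
  \<open>V\<close> because their ends are distinct, so the model is taken on
  \<open>set L \<inter> V\<close>.\<close>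

lemma no_asteroidal_triple:
  assumes "walk_avoiding E a b c p" "walk_avoiding E b a c q" "walk_avoiding E c a b r"
    and "set (p @ q @ r) \<subseteq> set L" "length L \<le> 10"
  shows False
proof -
  have "set (p @ q @ r) \<subseteq> V"
    using assms(1-3) walk_in[of p] walk_in[of q] walk_in[of r]
      walk_avoiding_ends[OF assms(1)] walk_avoiding_ends[OF assms(2)]
    by (simp add: walk_avoiding_def)
  then have V: "set p \<subseteq> set L \<inter> V" "set q \<subseteq> set L \<inter> V" "set r \<subseteq> set L \<inter> V"
    using assms(4) by auto
  have "card (set L \<inter> V) \<le> 10"
    using assms(5) card_length[of L] card_mono[of "set L" "set L \<inter> V"] by simp
  then obtain lo hi where "interval_model E (set L \<inter> V) lo hi"
    using small[of "set L \<inter> V"] by auto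
  then show False
    using interval_model_no_asteroidal_triple[OF _ V assms(1-3)] by blast
qed

text \<open>Some vertex of the cycle has an interval ending no later than those of both its cycle
  neighbours; \<open>interval_model_first_end\<close> makes these two adjacent. The same argument
  serves for length 5.\<close>

lemma chord_of_4_cycle:
  assumes "E a b" "E b c" "E c d" "E d a" "a \<noteq> c" "b \<noteq> d"
  shows "E a c \<or> E b d"
proof (rule ccontr)
  assume no: "\<not> ?thesis"
  have ne: "a \<noteq> b" "b \<noteq> c" "c \<noteq> d" "d \<noteq> a"
    using assms adj_irrefl by auto
  obtain lo hi where m: "interval_model E (set [a, b, c, d]) lo hi"
    using small_list[of "[a, b, c, d]"] assms adj_in by auto
  note f = interval_model_first_end[OF m]
  consider "hi a \<le> hi b" "hi a \<le> hi d" | "hi b \<le> hi a" "hi b \<le> hi c"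
    | "hi c \<le> hi b" "hi c \<le> hi d" | "hi d \<le> hi c" "hi d \<le> hi a"
    by linarith
  then show False
  proof cases
    case 1
    then show ?thesis
      using f[of a b d] assms(1,4,6) ne no adj_sym[of d a] by auto
  next
    case 2
    then show ?thesis
      using f[of b a c] assms(1,2,5) ne no adj_sym[of a b] by auto
  next
    case 3
    then show ?thesis
      using f[of c b d] assms(2,3,6) ne no adj_sym[of b c] by auto
  next
    case 4
    then show ?thesis
      using f[of d a c] assms(3,4,5) ne no adj_sym[of c d] by auto
  qed
qed

lemma chord_of_5_cycle:
  assumes "E a b" "E b c" "E c d" "E d e" "E e a"
    and "a \<noteq> c" "a \<noteq> d" "b \<noteq> d" "b \<noteq> e" "c \<noteq> e"
  shows "E a c \<or> E a d \<or> E b d \<or> E b e \<or> E c e"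
proof (rule ccontr)
  assume no: "\<not> ?thesis"
  have ne: "a \<noteq> b" "b \<noteq> c" "c \<noteq> d" "d \<noteq> e" "e \<noteq> a"
    using assms adj_irrefl by auto
  obtain lo hi where m: "interval_model E (set [a, b, c, d, e]) lo hi"
    using small_list[of "[a, b, c, d, e]"] assms adj_in by auto
  note f = interval_model_first_end[OF m]
  consider "hi a \<le> hi b" "hi a \<le> hi e" | "hi b \<le> hi a" "hi b \<le> hi c"
    | "hi c \<le> hi b" "hi c \<le> hi d" | "hi d \<le> hi c" "hi d \<le> hi e" | "hi e \<le> hi d" "hi e \<le> hi a"
    by linarith
  then show False
    using f[of a b e] f[of b a c] f[of c b d] f[of d c e] f[of e a d] assms ne no adj_commute
    by cases simp_all
qed

section \<open>A common form of daggers and double daggers\<close>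

text \<open>Daggers are the case \<open>c\<^sub>1 = c\<^sub>2\<close>; in a double dagger \<open>c\<^sub>1\<close> is moreover adjacent to \<open>b 0\<close> and
  \<open>c\<^sub>2\<close> to \<open>b (d + 1)\<close>. The adjacency of the two centers is not recorded, since a chordless
  4-cycle would result otherwise.\<close>

definition aw :: "'a \<Rightarrow> 'a \<Rightarrow> 'a \<Rightarrow> (nat \<Rightarrow> 'a) \<Rightarrow> nat \<Rightarrow> bool" where
  "aw s c\<^sub>1 c\<^sub>2 b d \<longleftrightarrow>
    2 \<le> d \<and> inj_on b {..Suc d} \<and>
    (\<forall>i\<le>Suc d. \<forall>j\<le>Suc d. E (b i) (b j) \<longleftrightarrow> i = Suc j \<or> j = Suc i) \<and>
    (\<forall>i\<le>Suc d. \<not> E s (b i)) \<and> E s c\<^sub>1 \<and> E s c\<^sub>2 \<and>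
    (\<forall>i\<in>{1..d}. E c\<^sub>1 (b i) \<and> E c\<^sub>2 (b i)) \<and> \<not> E c\<^sub>1 (b (Suc d)) \<and> \<not> E c\<^sub>2 (b 0)"

lemma aw_neq: "aw s c\<^sub>1 c\<^sub>2 b d \<Longrightarrow> i \<le> Suc d \<Longrightarrow> j \<le> Suc d \<Longrightarrow> b i = b j \<longleftrightarrow> i = j"
  by (auto simp: aw_def inj_on_def)

lemma aw_path: "aw s c\<^sub>1 c\<^sub>2 b d \<Longrightarrow> i \<le> Suc d \<Longrightarrow> j \<le> Suc d \<Longrightarrow> E (b i) (b j) \<longleftrightarrow> i = Suc j \<or> j = Suc i"
  by (simp add: aw_def)

lemma aw_terminal:
  assumes "aw s c\<^sub>1 c\<^sub>2 b d" "i \<le> Suc d"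
  shows "\<not> E s (b i)" "\<not> E (b i) s" "s \<noteq> b i" "b i \<noteq> s"
proof -
  show 1: "\<not> E s (b i)" "\<not> E (b i) s"
    using assms adj_sym by (auto simp: aw_def)
  \<comment> \<open>A neighbour on the path tells \<open>b i\<close> apart from \<open>s\<close>,
    which has none there.\<close>
  have "\<exists>j\<le>Suc d. E (b i) (b j)"
  proof (cases i)
    case 0
    then show ?thesis
      using aw_path[OF assms, of 1] by auto
  next
    case (Suc j)
    then show ?thesis
      using aw_path[OF assms, of j] assms(2) by (intro exI[of _ j]) auto
  qed
  then obtain j where "j \<le> Suc d" "E (b i) (b j)"
    by blast
  then have "\<not> E s (b j)" "E (b i) (b j)"
    using assms(1) by (auto simp: aw_def)
  then show "s \<noteq> b i" "b i \<noteq> s"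
    by auto
qed

lemma aw_center:
  assumes "aw s c\<^sub>1 c\<^sub>2 b d"
  shows "E s c\<^sub>1" "E s c\<^sub>2" "E c\<^sub>1 s" "E c\<^sub>2 s"
    and "Suc 0 \<le> i \<Longrightarrow> i \<le> d \<Longrightarrow> E c\<^sub>1 (b i)" "Suc 0 \<le> i \<Longrightarrow> i \<le> d \<Longrightarrow> E c\<^sub>2 (b i)"
    and "Suc 0 \<le> i \<Longrightarrow> i \<le> d \<Longrightarrow> E (b i) c\<^sub>1" "Suc 0 \<le> i \<Longrightarrow> i \<le> d \<Longrightarrow> E (b i) c\<^sub>2"
    and "\<not> E c\<^sub>1 (b (Suc d))" "\<not> E (b (Suc d)) c\<^sub>1" "\<not> E c\<^sub>2 (b 0)" "\<not> E (b 0) c\<^sub>2"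
  using assms adj_sym by (auto simp: aw_def)

lemma aw_center_neq:
  assumes "aw s c\<^sub>1 c\<^sub>2 b d" "i \<le> Suc d"
  shows "c\<^sub>1 \<noteq> b i" "c\<^sub>2 \<noteq> b i" "b i \<noteq> c\<^sub>1" "b i \<noteq> c\<^sub>2"
  using aw_terminal[OF assms] aw_center(1,2)[OF assms(1)] by auto

lemmas aw_rules = aw_path aw_terminal aw_center aw_center_neq

text \<open>Makes the two ends of the base interchangeable, so that later arguments treat one end
  only; the centers swap along with the ends.\<close>

lemma aw_rev:
  assumes "aw s c\<^sub>1 c\<^sub>2 b d"
  shows "aw s c\<^sub>2 c\<^sub>1 (\<lambda>i. b (Suc d - i)) d"
proof -
  have "inj_on (\<lambda>i. b (Suc d - i)) {..Suc d}"
    using aw_neq[OF assms] by (auto simp: inj_on_def)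
  moreover have "\<forall>i\<le>Suc d. \<forall>j\<le>Suc d. E (b (Suc d - i)) (b (Suc d - j)) \<longleftrightarrow> i = Suc j \<or> j = Suc i"
    using aw_path[OF assms] by auto
  moreover have "\<forall>i\<in>{1..d}. E c\<^sub>2 (b (Suc d - i)) \<and> E c\<^sub>1 (b (Suc d - i))"
    using aw_center(5,6)[OF assms] by auto
  ultimately show ?thesis
    using assms by (simp add: aw_def)
qed

text \<open>The source of shorter witnesses: a window of the base path is again an induced path
  missed by \<open>s\<close>, so only the conditions on the new centers \<open>x\<close> and
  \<open>y\<close> are left to supply.\<close>

lemma aw_subpath:
  assumes "aw s c\<^sub>1 c\<^sub>2 b d" "2 \<le> d'" "k + d' \<le> d" "E s x" "E s y"
    and "\<And>i. k < i \<Longrightarrow> i \<le> k + d' \<Longrightarrow> E x (b i)" "\<And>i. k < i \<Longrightarrow> i \<le> k + d' \<Longrightarrow> E y (b i)"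
    and "\<not> E x (b (Suc (k + d')))" "\<not> E y (b k)"
  shows "aw s x y (\<lambda>i. b (k + i)) d'"
proof -
  have "inj_on (\<lambda>i. b (k + i)) {..Suc d'}"
    using aw_neq[OF assms(1)] assms(3) by (auto simp: inj_on_def)
  moreover have "\<forall>i\<le>Suc d'. \<forall>j\<le>Suc d'. E (b (k + i)) (b (k + j)) \<longleftrightarrow> i = Suc j \<or> j = Suc i"
    using aw_path[OF assms(1)] assms(3) by auto
  moreover have "\<forall>i\<le>Suc d'. \<not> E s (b (k + i))"
    using assms(1,3) by (simp add: aw_def)
  ultimately show ?thesis
    using assms(2,4-) by (simp add: aw_def add.assoc)
qed

lemma aw_base_walk:
  assumes "aw s c\<^sub>1 c\<^sub>2 b d"
  shows "walk_avoiding E s (b 0) (b (Suc d)) (map b [0..<Suc (Suc d)])"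
proof -
  have "successively E (map b [0..<Suc (Suc d)])"
    using aw_path[OF assms] by (auto simp: successively_conv_nth simp del: upt_Suc)
  then show ?thesis
    using aw_terminal[OF assms] by (auto simp: walk_avoiding_def hd_map last_map simp del: upt_Suc)
qed

text \<open>The terminals \<open>s\<close>, \<open>b 0\<close>, \<open>b (Suc d)\<close> form an
  asteroidal triple within \<open>d + 5\<close> vertices, which is at most ten when
  \<open>d \<le> 5\<close>.\<close>

lemma aw_long:
  assumes "aw s c\<^sub>1 c\<^sub>2 b d"
  shows "6 \<le> d"
proof (rule ccontr)
  assume "\<not> 6 \<le> d"
  have d: "2 \<le> d" using assms by (simp add: aw_def)
  note f = aw_rules[OF assms] aw_neq[OF assms]
  show False
  proof (rule no_asteroidal_triple)
    show "walk_avoiding E s (b 0) (b (Suc d)) (map b [0..<Suc (Suc d)])"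
      by (rule aw_base_walk[OF assms])
    show "walk_avoiding E (b 0) s (b (Suc d)) [s, c\<^sub>2, b d, b (Suc d)]"
      using d by (simp add: walk_avoiding_def f)
    show "walk_avoiding E (b (Suc d)) s (b 0) [s, c\<^sub>1, b 1, b 0]"
      using d by (simp add: walk_avoiding_def f)
    show "set (map b [0..<Suc (Suc d)] @ [s, c\<^sub>2, b d, b (Suc d)] @ [s, c\<^sub>1, b 1, b 0])
      \<subseteq> set (s # c\<^sub>1 # c\<^sub>2 # map b [0..<Suc (Suc d)])"
      by (auto simp del: upt_Suc)
    show "length (s # c\<^sub>1 # c\<^sub>2 # map b [0..<Suc (Suc d)]) \<le> 10"
      using \<open>\<not> 6 \<le> d\<close> by simp
  qed
qed

section \<open>Neighbours of the base and of the shallow terminal\<close>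

text \<open>If \<open>c\<close> missed \<open>s\<close>, then \<open>c\<close> would be a shortcut
  from \<open>b 1\<close> to \<open>b d\<close>, and the three terminals would be an asteroidal
  triple within eight vertices, however long the base is.\<close>

lemma aw_common_neighbour:
  assumes "aw s c\<^sub>1 c\<^sub>2 b d" "E c (b 1)" "E c (b d)"
  shows "E s c"
proof (rule ccontr)
  assume no: "\<not> E s c"
  have d: "6 \<le> d" by (rule aw_long[OF assms(1)])
  note f = aw_rules[OF assms(1)] aw_neq[OF assms(1)]
  have c: "E c (b (Suc 0))" "E (b (Suc 0)) c" "E c (b d)" "E (b d) c" "c \<noteq> s" "s \<noteq> c"
    using assms adj_sym aw_terminal[OF assms(1), of 1] d by auto
  show False
  proof (rule no_asteroidal_triple)
    show "walk_avoiding E s (b 0) (b (Suc d)) [b 0, b 1, c, b d, b (Suc d)]"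
      using d no c by (simp add: walk_avoiding_def f)
    show "walk_avoiding E (b 0) s (b (Suc d)) [s, c\<^sub>2, b d, b (Suc d)]"
      using d by (simp add: walk_avoiding_def f)
    show "walk_avoiding E (b (Suc d)) s (b 0) [s, c\<^sub>1, b 1, b 0]"
      using d by (simp add: walk_avoiding_def f)
    show "set ([b 0, b 1, c, b d, b (Suc d)] @ [s, c\<^sub>2, b d, b (Suc d)] @ [s, c\<^sub>1, b 1, b 0])
      \<subseteq> set [s, c, c\<^sub>1, c\<^sub>2, b 0, b 1, b d, b (Suc d)]"
      by auto
  qed simp
qed

text \<open>Otherwise \<open>x\<close>, \<open>b 0\<close>, \<open>b 1\<close>,
  \<open>c\<^sub>2\<close> form a chordless 4-cycle, or a chordless 5-cycle together with
  \<open>s\<close>, according to whether \<open>x\<close> and \<open>c\<^sub>2\<close> are adjacent.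
  The center must be \<open>c\<^sub>2\<close>, the one known to miss \<open>b 0\<close>.\<close>

lemma aw_neighbour_left_end:
  assumes "aw s c\<^sub>1 c\<^sub>2 b d" "E s x" "\<not> E x (b 1)"
  shows "\<not> E x (b 0)"
proof
  assume x: "E x (b 0)"
  have d: "6 \<le> d" by (rule aw_long[OF assms(1)])
  note f = aw_rules[OF assms(1)] aw_neq[OF assms(1)]
  have ne: "x \<noteq> b 1" "x \<noteq> c\<^sub>2"
    using f(2)[of 1] aw_center(6)[OF assms(1), of 1] assms(2,3) d by auto
  show False
  proof (cases "E x c\<^sub>2")
    case True
    then show ?thesis
      using chord_of_4_cycle[of x "b 0" "b 1" c\<^sub>2] assms(3) x ne adj_sym[of x c\<^sub>2] d f by simp
  next
    case False
    then show ?thesis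
      using chord_of_5_cycle[of s x "b 0" "b 1" c\<^sub>2] assms(2,3) x ne d f by simp
  qed
qed

lemma aw_neighbour_off_base:
  assumes "aw s c\<^sub>1 c\<^sub>2 b d" "E s x" "\<And>i. 1 \<le> i \<Longrightarrow> i \<le> d \<Longrightarrow> \<not> E x (b i)" "i \<le> Suc d"
  shows "\<not> E x (b i)"
proof -
  have d: "6 \<le> d" by (rule aw_long[OF assms(1)])
  have "\<not> E x (b 0)"
    using aw_neighbour_left_end[OF assms(1,2)] assms(3)[of 1] d by simp
  moreover have "\<not> E x (b (Suc d))"
    using aw_neighbour_left_end[OF aw_rev[OF assms(1)] assms(2)] assms(3)[of d] d by simp
  ultimately show ?thesis
    using assms(3)[of i] assms(4) by (cases "i = 0"; cases "i = Suc d") auto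
qed

text \<open>The point is that \<open>v\<close> is adjacent to both centers. If it missed a common
  neighbour \<open>c\<close> of \<open>b 1\<close> and \<open>b d\<close>, then \<open>v\<close>,
  \<open>b 0\<close>, \<open>b (Suc d)\<close> would be an asteroidal triple within nine vertices:
  \<open>c\<close> shortcuts the base, and \<open>v\<close> reaches the ends through
  \<open>s\<close>.\<close>

lemma aw_transfer:
  assumes "aw s c\<^sub>1 c\<^sub>2 b d" "E s v" "\<And>i. 1 \<le> i \<Longrightarrow> i \<le> d \<Longrightarrow> \<not> E v (b i)"
  shows "aw v c\<^sub>1 c\<^sub>2 b d"
proof -
  have d: "6 \<le> d" by (rule aw_long[OF assms(1)])
  note f = aw_rules[OF assms(1)] aw_neq[OF assms(1)]
  have off: "\<not> E v (b i)" "\<not> E (b i) v" "v \<noteq> b i" "b i \<noteq> v" if "i \<le> Suc d" for i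
    using aw_neighbour_off_base[OF assms(1,2,3) that] adj_sym aw_terminal[OF assms(1) that] assms(2)
    by auto
  have s: "E s v" "E v s" using assms(2) adj_sym by auto
  have "E v c" if c: "E c (b 1)" "E c (b d)" for c
  proof (rule ccontr)
    assume no: "\<not> E v c"
    have c: "E c (b (Suc 0))" "E (b (Suc 0)) c" "E c (b d)" "E (b d) c" "c \<noteq> v" "v \<noteq> c"
      using c adj_sym off(1)[of 1] d by auto
    show False
    proof (rule no_asteroidal_triple)
      show "walk_avoiding E v (b 0) (b (Suc d)) [b 0, b 1, c, b d, b (Suc d)]"
        using d no c by (simp add: walk_avoiding_def f off)
      show "walk_avoiding E (b 0) v (b (Suc d)) [v, s, c\<^sub>2, b d, b (Suc d)]"
        using d s by (simp add: walk_avoiding_def f off)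
      show "walk_avoiding E (b (Suc d)) v (b 0) [v, s, c\<^sub>1, b 1, b 0]"
        using d s by (simp add: walk_avoiding_def f off)
      show "set ([b 0, b 1, c, b d, b (Suc d)] @ [v, s, c\<^sub>2, b d, b (Suc d)] @ [v, s, c\<^sub>1, b 1, b 0])
        \<subseteq> set [v, s, c, c\<^sub>1, c\<^sub>2, b 0, b 1, b d, b (Suc d)]"
        by auto
    qed simp
  qed
  then have "E v c\<^sub>1" "E v c\<^sub>2"
    using aw_center[OF assms(1)] d by auto
  then show ?thesis
    using assms(1) off by (simp add: aw_def)
qed

section \<open>Shortening the base\<close>

text \<open>The asteroidal triple is \<open>s\<close>, \<open>b (i - 2)\<close>, \<open>b (i + 2)\<close>, or \<open>s\<close>, \<open>b 0\<close>, \<open>b 3\<close> when \<open>i = 1\<close>.\<close>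

lemma aw_isolated_base_neighbour:
  assumes "aw s c\<^sub>1 c\<^sub>2 b d" "E s x" "1 \<le> i" "i \<le> d" "E x (b i)"
    and "\<not> E x (b (i - 1))" "\<not> E x (b (Suc i))"
  shows False
proof -
  \<comment> \<open>The restriction to \<open>i < d\<close> guarantees that \<open>b (i + 2)\<close>
    is on the path; reversal turns the remaining case \<open>i = d\<close> into
    \<open>i = 1\<close>. Below, \<open>k\<close> is \<open>i - 1\<close> and \<open>m\<close> is
    \<open>i - 2\<close>.\<close>
  have *: False if aw: "aw s c\<^sub>1 c\<^sub>2 b d" and i: "1 \<le> i" "i < d" "E x (b i)"
      "\<not> E x (b (i - 1))" "\<not> E x (b (Suc i))" for c\<^sub>1 c\<^sub>2 b i
  proof -
    have d: "6 \<le> d" by (rule aw_long[OF aw])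
    note f = aw_rules[OF aw] aw_neq[OF aw]
    obtain k where k: "i = Suc k" using i(1) by (cases i) auto
    have x: "E s x" "E x s" "E x (b (Suc k))" "E (b (Suc k)) x" "\<not> E x (b k)" "\<not> E (b k) x"
      "\<not> E x (b (Suc (Suc k)))" "\<not> E (b (Suc (Suc k))) x"
      using assms(2) i k adj_sym by auto
    have xb: "x \<noteq> b j" "b j \<noteq> x" if "j \<le> Suc d" for j
      using x(1) f(2)[OF that] by auto
    have "\<not> E x (b (Suc (Suc (Suc k))))"
      using chord_of_4_cycle[of x "b (Suc k)" "b (Suc (Suc k))" "b (Suc (Suc (Suc k)))"]
        i k x xb f adj_commute[of x] by auto
    then have far: "\<not> E x (b (Suc (Suc (Suc k))))" "\<not> E (b (Suc (Suc (Suc k)))) x"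
      using adj_sym by auto
    show False
    proof (cases k)
      case 0
      show ?thesis
      proof (rule no_asteroidal_triple[where L = "[b 0, b 1, b 2, b 3, s, c\<^sub>2, x]"])
        show "walk_avoiding E s (b 0) (b 3) [b 0, b 1, b 2, b 3]"
          using d by (simp add: walk_avoiding_def f eval_nat_numeral)
        show "walk_avoiding E (b 0) s (b 3) [s, c\<^sub>2, b 3]"
          using d by (simp add: walk_avoiding_def f eval_nat_numeral)
        show "walk_avoiding E (b 3) s (b 0) [s, x, b 1, b 0]"
          using d x xb far 0 by (simp add: walk_avoiding_def f eval_nat_numeral)
      qed auto
    next
      case (Suc m)
      have "\<not> E x (b m)"
        using chord_of_4_cycle[of x "b m" "b (Suc m)" "b (Suc (Suc m))"] i k x xb f Suc by auto
      then have near: "\<not> E x (b m)" "\<not> E (b m) x"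
        using adj_sym by auto
      show ?thesis
      proof (rule no_asteroidal_triple[where L = "[b m, b (m + 1), b (m + 2), b (m + 3), b (m + 4), s, x]"])
        show "walk_avoiding E s (b m) (b (m + 4)) [b m, b (m + 1), b (m + 2), b (m + 3), b (m + 4)]"
          using i k Suc by (simp add: walk_avoiding_def f eval_nat_numeral)
        show "walk_avoiding E (b m) s (b (m + 4)) [s, x, b (m + 2), b (m + 3), b (m + 4)]"
          using i k Suc x xb near by (simp add: walk_avoiding_def f eval_nat_numeral)
        show "walk_avoiding E (b (m + 4)) s (b m) [s, x, b (m + 2), b (m + 1), b m]"
          using i k Suc x xb far by (simp add: walk_avoiding_def f eval_nat_numeral)
      qed auto
    qed
  qed
  show False
  proof (cases "i < d")
    case True
    then show ?thesis
      using *[OF assms(1,3) _ assms(5-7)] by simp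
  next
    case False
    then show ?thesis
      using *[OF aw_rev[OF assms(1)], of "Suc d - i"] assms(3-7) aw_long[OF assms(1)]
      by (simp add: Suc_diff_le)
  qed
qed

text \<open>The neighbour \<open>x\<close> replaces one or both centers, and the base becomes a maximal interval of
  neighbours of \<open>x\<close> around \<open>b i\<close>.\<close>

lemma aw_shrink:
  assumes "aw s c\<^sub>1 c\<^sub>2 b d" "E s x" "1 \<le> i" "i \<le> d" "E x (b i)" "1 \<le> j" "j \<le> d" "\<not> E x (b j)"
  obtains e\<^sub>1 e\<^sub>2 k d' where "d' < d" "k + d' \<le> d" "aw s e\<^sub>1 e\<^sub>2 (\<lambda>i. b (k + i)) d'"
proof -
  have d: "6 \<le> d" by (rule aw_long[OF assms(1)])
  note f = aw_rules[OF assms(1)] aw_neq[OF assms(1)]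
  have xb: "x \<noteq> b j" "b j \<noteq> x" if "j \<le> Suc d" for j
    using assms(2) f(2)[OF that] by auto
  have x: "E s x" "E x s" using assms(2) adj_sym by auto
  \<comment> \<open>The run \<open>{p..q}\<close> is taken on the whole path, so
    \<open>p = 0\<close> and \<open>q = Suc d\<close> can occur. Values of \<open>b\<close> beyond
    \<open>Suc d\<close> are arbitrary, hence the explicit bound in \<open>q\<close>.\<close>
  define p where "p = (LEAST p. \<forall>j\<in>{p..i}. E x (b j))"
  define q where "q = (GREATEST q. q \<le> Suc d \<and> (\<forall>j\<in>{i..q}. E x (b j)))"
  have p: "\<forall>j\<in>{p..i}. E x (b j)"
    unfolding p_def by (rule LeastI[of _ i]) (use assms(5) in auto)
  have pi: "p \<le> i"
    unfolding p_def by (rule Least_le) (use assms(5) in auto)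
  have p0: "\<not> E x (b (p - 1))" if "p \<noteq> 0"
  proof
    assume "E x (b (p - 1))"
    then have "\<forall>j\<in>{p - 1..i}. E x (b j)"
      using p by (metis Suc_pred' atLeastAtMost_iff le_neq_implies_less not_gr_zero not_less_eq_eq order_refl Suc_leI that)
    then have "p \<le> p - 1"
      unfolding p_def by (rule Least_le)
    then show False using that by simp
  qed
  have "q \<le> Suc d \<and> (\<forall>j\<in>{i..q}. E x (b j))"
    unfolding q_def by (rule GreatestI_nat[of _ i "Suc d"]) (use assms(4,5) in auto)
  then have q: "q \<le> Suc d" "\<forall>j\<in>{i..q}. E x (b j)" by auto
  have iq: "i \<le> q"
    unfolding q_def by (rule Greatest_le_nat[of _ i "Suc d"]) (use assms(4,5) in auto)
  have q1: "\<not> E x (b (Suc q))" if "q \<le> d"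
  proof
    assume "E x (b (Suc q))"
    then have "Suc q \<le> Suc d \<and> (\<forall>j\<in>{i..Suc q}. E x (b j))"
      using q that by (auto simp: le_Suc_eq)
    then have "Suc q \<le> q"
      unfolding q_def by (rule Greatest_le_nat[of _ _ "Suc d"]) auto
    then show False by simp
  qed
  have pq: "E x (b j)" "E (b j) x" if "p \<le> j" "j \<le> q" for j
    using p q(2) that adj_sym by (cases "j \<le> i"; auto)+
  have out: "j < p \<or> q < j"
    using pq[of j] assms(8) by (meson not_le)
  \<comment> \<open>If the run stops inside the path on both sides, \<open>b (p - 1)\<close> and
    \<open>b (Suc q)\<close> become the new ends and \<open>x\<close> both centers. If it contains
    \<open>b 0\<close>, that vertex stays the left end and \<open>c\<^sub>2\<close>, which misses
    it, stays a center; the right side is the mirror image. Runs with a single vertex in the base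
    are contradictory, and \<open>out\<close> forbids the run to cover the whole path.\<close>
  consider "p \<noteq> 0" "q \<le> d" "p = q" | "p \<noteq> 0" "q \<le> d" "p < q"
    | "p = 0" "q = 1" | "p = 0" "1 < q" "q \<le> d" | "q = Suc d" "p = d" | "q = Suc d" "p \<noteq> 0" "p < d"
    using out pi iq q(1) assms(3,4,6,7) by linarith
  then show thesis
  proof cases
    case 1
    then show ?thesis
      using aw_isolated_base_neighbour[OF assms(1,2), of p] p0 q1 pq by auto
  next
    case 2
    have "aw s x x (\<lambda>i. b (p - 1 + i)) (q - p + 1)"
      by (rule aw_subpath[OF assms(1)]) (use 2 p0 q1 pq x in auto)
    \<comment> \<open>The new base is part of the old one and omits \<open>b j\<close>.\<close>
    moreover have "q - p + 1 < d"
      using 2 out assms(6,7) by auto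
    ultimately show ?thesis
      using that[of "q - p + 1" "p - 1" x x] 2 by simp
  next
    case 3
    have False
    proof (rule no_asteroidal_triple[where L = "[b 0, b 1, b 2, s, c\<^sub>2, x]"])
      have n: "\<not> E x (b 2)" "\<not> E (b 2) x"
        using 3 q1 d adj_sym by (auto simp: eval_nat_numeral)
      show "walk_avoiding E s (b 0) (b 2) [b 0, b 1, b 2]"
        using d by (simp add: walk_avoiding_def f eval_nat_numeral)
      show "walk_avoiding E (b 0) s (b 2) [s, c\<^sub>2, b 2]"
        using d by (simp add: walk_avoiding_def f eval_nat_numeral)
      show "walk_avoiding E (b 2) s (b 0) [s, x, b 0]"
        using d x xb pq 3 n by (simp add: walk_avoiding_def f eval_nat_numeral)
    qed auto
    then show ?thesis ..
  next
    case 4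
    have "aw s x c\<^sub>2 (\<lambda>i. b (0 + i)) q"
      by (rule aw_subpath[OF assms(1)]) (use 4 q1 pq x f in auto)
    moreover have "q < d"
      using 4 out assms(6,7) by auto
    ultimately show ?thesis
      using that[of q 0 x c\<^sub>2] 4 by simp
  next
    case 5
    obtain m where m: "d = Suc m" using d by (cases d) auto
    have False
    proof (rule no_asteroidal_triple[where L = "[b m, b d, b (Suc d), s, x, c\<^sub>1]"])
      have n: "\<not> E x (b m)" "\<not> E (b m) x"
        using 5 p0 d m adj_sym by auto
      show "walk_avoiding E s (b m) (b (Suc d)) [b m, b d, b (Suc d)]"
        using d m by (simp add: walk_avoiding_def f)
      show "walk_avoiding E (b m) s (b (Suc d)) [s, x, b (Suc d)]"
        using d x xb pq 5 n m by (simp add: walk_avoiding_def f)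
      show "walk_avoiding E (b (Suc d)) s (b m) [s, c\<^sub>1, b m]"
        using d m aw_center(9,10)[OF assms(1)] by (simp add: walk_avoiding_def f)
    qed auto
    then show ?thesis ..
  next
    case 6
    have "aw s c\<^sub>1 x (\<lambda>i. b (p - 1 + i)) (d - p + 1)"
      by (rule aw_subpath[OF assms(1)]) (use 6 p0 pq x f in auto)
    moreover have "d - p + 1 < d"
      using 6 out assms(6,7) by auto
    ultimately show ?thesis
      using that[of "d - p + 1" "p - 1" c\<^sub>1 x] 6 by simp
  qed
qed

section \<open>The module around the shallow terminal\<close>

lemma aw_simplicial:
  assumes "finite V"
    and modules: "\<And>M. M \<subseteq> V \<Longrightarrow> (\<forall>u\<in>M. \<forall>v\<in>M. {w. E u w} - M = {w. E v w} - M) \<Longrightarrow>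
      1 < card M \<Longrightarrow> card M < card V \<Longrightarrow> \<forall>u\<in>M. \<forall>v\<in>M. u \<noteq> v \<longrightarrow> E u v"
    and "aw s e\<^sub>1 e\<^sub>2 b' d'" "E s x" "E s y" "x \<noteq> y"
  shows "E x y"
proof -
  \<comment> \<open>The minimum ranges over all centers and bases, with \<open>s\<close>
    fixed.\<close>
  define d where "d = (LEAST d. \<exists>c\<^sub>1 c\<^sub>2 b. aw s c\<^sub>1 c\<^sub>2 b d)"
  have "\<exists>c\<^sub>1 c\<^sub>2 b. aw s c\<^sub>1 c\<^sub>2 b d"
    unfolding d_def by (rule LeastI[of _ d']) (use assms(3) in blast)
  then obtain c\<^sub>1 c\<^sub>2 b where aw: "aw s c\<^sub>1 c\<^sub>2 b d"
    by blast
  have least: "d \<le> k" if "aw s c\<^sub>1 c\<^sub>2 b k" for c\<^sub>1 c\<^sub>2 b k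
    unfolding d_def by (rule Least_le) (use that in blast)
  have d: "6 \<le> d"
    by (rule aw_long[OF aw])
  define free where "free v \<longleftrightarrow> (\<forall>i\<in>{1..d}. \<not> E v (b i))" for v
  define R where "R = {(u, v). E u v \<and> free u \<and> free v}"
  define M where "M = R\<^sup>* `` {s}"
  define C where "C = {w. \<forall>i\<in>{1..d}. E w (b i)}"
  \<comment> \<open>Stated for arbitrary windows and starting vertices: it moves the chosen witness
    from \<open>s\<close> to all of \<open>M\<close>, and also moves a shortened witness found at
    some \<open>v\<close> in \<open>M\<close> back to \<open>s\<close>.\<close>
  have transfer: "aw v c\<^sub>1 c\<^sub>2 (\<lambda>i. b (k + i)) n"
    if "(u, v) \<in> R\<^sup>*" "aw u c\<^sub>1 c\<^sub>2 (\<lambda>i. b (k + i)) n" "k + n \<le> d" for u v c\<^sub>1 c\<^sub>2 k n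
    using that(1,2)
  proof induction
    case (step v w)
    then show ?case
      using aw_transfer[of v c\<^sub>1 c\<^sub>2 "\<lambda>i. b (k + i)" n w] that(3) by (auto simp: R_def free_def)
  qed
  have "sym R"
    using adj_sym by (auto simp: R_def sym_def)
  then have to_s: "(v, s) \<in> R\<^sup>*" if "v \<in> M" for v
    using that sym_rtrancl[of R] by (auto simp: M_def dest: symD)
  have M_aw: "aw v c\<^sub>1 c\<^sub>2 b d" if "v \<in> M" for v
    using transfer[of s v c\<^sub>1 c\<^sub>2 0 d] that aw by (auto simp: M_def)
  have M_free: "free v" if "v \<in> M" for v
    using M_aw[OF that] by (auto simp: free_def aw_def)
  have M_C: "E v w" "w \<notin> M" if "v \<in> M" "w \<in> C" for v w
  proof -
    show "E v w"
      using aw_common_neighbour[OF M_aw[OF that(1)]] that(2) d by (auto simp: C_def)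
    show "w \<notin> M"
      using M_free[of w] that(2) d by (force simp: C_def free_def)
  qed
  \<comment> \<open>A vertex \<open>w\<close> outside \<open>M\<close> cannot be free, so outside
    \<open>C\<close> it would be adjacent to part of the base only. Then \<open>aw_shrink\<close> at
    \<open>v\<close> gives a shorter witness, which transferred back to \<open>s\<close> contradicts
    the choice of \<open>d\<close>.\<close>
  have out: "w \<in> C" if v: "v \<in> M" and w: "E v w" "w \<notin> M" for v w
  proof (rule ccontr)
    assume "w \<notin> C"
    then obtain j where j: "1 \<le> j" "j \<le> d" "\<not> E w (b j)"
      by (auto simp: C_def)
    have "\<not> free w"
      using v w M_free[OF v] by (auto simp: M_def R_def intro: rtrancl_into_rtrancl)
    then obtain i where i: "1 \<le> i" "i \<le> d" "E w (b i)"
      by (auto simp: free_def)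
    obtain e\<^sub>1 e\<^sub>2 k n where n: "n < d" "k + n \<le> d" "aw v e\<^sub>1 e\<^sub>2 (\<lambda>i. b (k + i)) n"
      by (rule aw_shrink[OF M_aw[OF v] w(1) i j])
    show False
      using least[OF transfer[OF to_s[OF v] n(3,2)]] n(1) by simp
  qed
  have s: "s \<in> M"
    by (simp add: M_def)
  have M_V: "M \<subseteq> V"
    using M_aw adj_in aw_center(1) by blast
  \<comment> \<open>A vertex outside \<open>M\<close>, needed for \<open>M\<close> to be a
    nontrivial module: \<open>b 1\<close> is adjacent to \<open>b 2\<close>, hence not free.\<close>
  have "b 1 \<in> V - M"
    using adj_in[of "b 1" "b 2"] M_free[of "b 1"] aw_path[OF aw, of 1 2] d by (force simp: free_def)
  then have "card M < card V"
    using M_V \<open>finite V\<close> by (intro psubset_card_mono) auto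
  moreover have "{w. E v w} - M = C" if "v \<in> M" for v
    using M_C out that by blast
  ultimately have clique: "E u v" if "u \<in> M" "v \<in> M" "u \<noteq> v" for u v
  proof -
    have "card {u, v} \<le> card M"
      using that M_V \<open>finite V\<close> by (intro card_mono) (auto intro: finite_subset)
    then show ?thesis
      using modules[OF M_V] \<open>card M < card V\<close> \<open>\<And>v. v \<in> M \<Longrightarrow> {w. E v w} - M = C\<close> that by simp
  qed
  \<comment> \<open>The vertices \<open>b 1\<close> and \<open>b 3\<close> are nonadjacent common
    neighbours of \<open>u\<close> and \<open>v\<close>, so the chord of the 4-cycle joins
    \<open>u\<close> and \<open>v\<close>.\<close>
  have C_clique: "E u v" if "u \<in> C" "v \<in> C" "u \<noteq> v" for u v
    using chord_of_4_cycle[of u "b 1" v "b 3"] that d adj_sym[of v "b 1"] adj_sym[of u "b 3"]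
      aw_path[OF aw, of 1 3] aw_neq[OF aw, of 1 3]
    by (auto simp: C_def)
  show ?thesis
    using clique C_clique M_C(1) out s assms(4-6) adj_sym by metis
qed

section \<open>Recognizing daggers and double daggers\<close>

text \<open>The single center misses both \<open>l\<close> and \<open>r\<close>, so it can play both
  roles. Every adjacency is settled by comparing two-element sets of distinct vertices.\<close>

lemma aw_of_dagger:
  assumes d: "3 \<le> length B"
    and dist: "distinct (s # c # l # B @ [r])"
    and edges: "\<And>u v. u \<in> set (s # c # l # B @ [r]) \<Longrightarrow> v \<in> set (s # c # l # B @ [r]) \<Longrightarrow>
      E u v \<longleftrightarrow> {u, v} \<in> {{(l # B @ [r]) ! i, (l # B @ [r]) ! (i + 1)} | i. i \<le> length B} \<union>
        {{c, s}} \<union> {{c, (l # B @ [r]) ! i} | i. 1 \<le> i \<and> i \<le> length B}"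
  shows "aw s c c (\<lambda>i. (l # B @ [r]) ! i) (length B)"
proof -
  define b where "b i = (l # B @ [r]) ! i" for i
  define n where "n = length B"
  have mem: "b i \<in> set (s # c # l # B @ [r])" if "i \<le> Suc n" for i
    using nth_mem[of i "l # B @ [r]"] that unfolding b_def n_def by auto
  have ne: "b i \<noteq> s" "b i \<noteq> c" "s \<noteq> b i" "c \<noteq> b i" if "i \<le> Suc n" for i
    using nth_mem[of i "l # B @ [r]"] that dist unfolding b_def n_def by auto
  have eq: "b i = b j \<longleftrightarrow> i = j" if "i \<le> Suc n" "j \<le> Suc n" for i j
    using nth_eq_iff_index_eq[of "l # B @ [r]" i j] that dist unfolding b_def n_def by auto
  have sc: "s \<noteq> c" "c \<noteq> s" using dist by auto
  have adj: "E u v \<longleftrightarrow> (\<exists>i\<le>n. {u, v} = {b i, b (Suc i)}) \<or> {u, v} = {c, s} \<or>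
      (\<exists>i. 1 \<le> i \<and> i \<le> n \<and> {u, v} = {c, b i})"
    if "u \<in> set (s # c # l # B @ [r])" "v \<in> set (s # c # l # B @ [r])" for u v
    using edges[OF that] unfolding b_def n_def by auto
  have in_set: "s \<in> set (s # c # l # B @ [r])" "c \<in> set (s # c # l # B @ [r])" by auto
  have 1: "E (b i) (b j) \<longleftrightarrow> i = Suc j \<or> j = Suc i" if "i \<le> Suc n" "j \<le> Suc n" for i j
    unfolding adj[OF mem[OF that(1)] mem[OF that(2)]] using that by (auto simp: doubleton_eq_iff eq ne)
  have 2: "\<not> E s (b i)" if "i \<le> Suc n" for i
    unfolding adj[OF in_set(1) mem[OF that]] using that sc by (auto simp: doubleton_eq_iff eq ne)
  have 3: "E s c"
    unfolding adj[OF in_set] by auto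
  have 4: "E c (b i) \<longleftrightarrow> 1 \<le> i \<and> i \<le> n" if "i \<le> Suc n" for i
    unfolding adj[OF in_set(2) mem[OF that]] using that sc by (auto simp: doubleton_eq_iff eq ne)
  have "aw s c c b n"
    using 1 2 3 4 eq d by (auto simp: aw_def inj_on_def n_def)
  then show ?thesis
    unfolding b_def n_def .
qed

lemma aw_of_double_dagger:
  assumes d: "2 \<le> length B"
    and dist: "distinct (s # c\<^sub>1 # c\<^sub>2 # l # B @ [r])"
    and edges: "\<And>u v. u \<in> set (s # c\<^sub>1 # c\<^sub>2 # l # B @ [r]) \<Longrightarrow> v \<in> set (s # c\<^sub>1 # c\<^sub>2 # l # B @ [r]) \<Longrightarrow>
      E u v \<longleftrightarrow> {u, v} \<in> {{(l # B @ [r]) ! i, (l # B @ [r]) ! (i + 1)} | i. i \<le> length B} \<union>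
        {{c\<^sub>1, c\<^sub>2}, {c\<^sub>1, s}, {c\<^sub>2, s}, {c\<^sub>1, l}, {c\<^sub>2, r}} \<union>
        {{c, (l # B @ [r]) ! i} | c i. c \<in> {c\<^sub>1, c\<^sub>2} \<and> 1 \<le> i \<and> i \<le> length B}"
  shows "aw s c\<^sub>1 c\<^sub>2 (\<lambda>i. (l # B @ [r]) ! i) (length B)"
proof -
  define b where "b i = (l # B @ [r]) ! i" for i
  define n where "n = length B"
  have mem: "b i \<in> set (s # c\<^sub>1 # c\<^sub>2 # l # B @ [r])" if "i \<le> Suc n" for i
    using nth_mem[of i "l # B @ [r]"] that unfolding b_def n_def by auto
  have ne: "b i \<noteq> s" "b i \<noteq> c\<^sub>1" "b i \<noteq> c\<^sub>2" "s \<noteq> b i" "c\<^sub>1 \<noteq> b i" "c\<^sub>2 \<noteq> b i" if "i \<le> Suc n" for i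
    using nth_mem[of i "l # B @ [r]"] that dist unfolding b_def n_def by auto
  have eq: "b i = b j \<longleftrightarrow> i = j" if "i \<le> Suc n" "j \<le> Suc n" for i j
    using nth_eq_iff_index_eq[of "l # B @ [r]" i j] that dist unfolding b_def n_def by auto
  have sc: "s \<noteq> c\<^sub>1" "c\<^sub>1 \<noteq> s" "s \<noteq> c\<^sub>2" "c\<^sub>2 \<noteq> s" "c\<^sub>1 \<noteq> c\<^sub>2" "c\<^sub>2 \<noteq> c\<^sub>1" using dist by auto
  have lr: "l = b 0" "r = b (Suc n)" by (simp_all add: b_def n_def nth_append)
  \<comment> \<open>The edge set is unfolded into a disjunction, with \<open>l\<close> and
    \<open>r\<close> written as \<open>b 0\<close> and \<open>b (Suc n)\<close> and the two centers
    split, so that doubletons can be compared case by case.\<close>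
  have edge_set: "e \<in> {{(l # B @ [r]) ! i, (l # B @ [r]) ! (i + 1)} | i. i \<le> length B} \<union>
      {{c\<^sub>1, c\<^sub>2}, {c\<^sub>1, s}, {c\<^sub>2, s}, {c\<^sub>1, l}, {c\<^sub>2, r}} \<union>
      {{c, (l # B @ [r]) ! i} | c i. c \<in> {c\<^sub>1, c\<^sub>2} \<and> 1 \<le> i \<and> i \<le> length B} \<longleftrightarrow>
      (\<exists>i\<le>n. e = {b i, b (Suc i)}) \<or>
      e = {c\<^sub>1, c\<^sub>2} \<or> e = {c\<^sub>1, s} \<or> e = {c\<^sub>2, s} \<or> e = {c\<^sub>1, b 0} \<or> e = {c\<^sub>2, b (Suc n)} \<or>
      (\<exists>i. 1 \<le> i \<and> i \<le> n \<and> e = {c\<^sub>1, b i}) \<or> (\<exists>i. 1 \<le> i \<and> i \<le> n \<and> e = {c\<^sub>2, b i})" for e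
  proof -
    have "e \<in> {{b i, b (i + 1)} | i. i \<le> n} \<longleftrightarrow> (\<exists>i\<le>n. e = {b i, b (Suc i)})"
      by auto
    moreover have "e \<in> {{c, b i} | c i. c \<in> {c\<^sub>1, c\<^sub>2} \<and> 1 \<le> i \<and> i \<le> n} \<longleftrightarrow>
      (\<exists>i. 1 \<le> i \<and> i \<le> n \<and> e = {c\<^sub>1, b i}) \<or> (\<exists>i. 1 \<le> i \<and> i \<le> n \<and> e = {c\<^sub>2, b i})"
      unfolding mem_Collect_eq insert_iff empty_iff by metis
    ultimately show ?thesis
      unfolding b_def[symmetric] n_def[symmetric] lr[symmetric] by (simp only: Un_iff insert_iff empty_iff simp_thms disj_assoc)
  qed
  have adj: "E u v \<longleftrightarrow> (\<exists>i\<le>n. {u, v} = {b i, b (Suc i)}) \<or>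
      {u, v} = {c\<^sub>1, c\<^sub>2} \<or> {u, v} = {c\<^sub>1, s} \<or> {u, v} = {c\<^sub>2, s} \<or> {u, v} = {c\<^sub>1, b 0} \<or> {u, v} = {c\<^sub>2, b (Suc n)} \<or>
      (\<exists>i. 1 \<le> i \<and> i \<le> n \<and> {u, v} = {c\<^sub>1, b i}) \<or> (\<exists>i. 1 \<le> i \<and> i \<le> n \<and> {u, v} = {c\<^sub>2, b i})"
    if "u \<in> set (s # c\<^sub>1 # c\<^sub>2 # l # B @ [r])" "v \<in> set (s # c\<^sub>1 # c\<^sub>2 # l # B @ [r])" for u v
    unfolding edges[OF that] edge_set ..
  have in_set: "s \<in> set (s # c\<^sub>1 # c\<^sub>2 # l # B @ [r])" "c\<^sub>1 \<in> set (s # c\<^sub>1 # c\<^sub>2 # l # B @ [r])"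
    "c\<^sub>2 \<in> set (s # c\<^sub>1 # c\<^sub>2 # l # B @ [r])" by auto
  have 1: "E (b i) (b j) \<longleftrightarrow> i = Suc j \<or> j = Suc i" if "i \<le> Suc n" "j \<le> Suc n" for i j
    unfolding adj[OF mem[OF that(1)] mem[OF that(2)]] using that by (auto simp: doubleton_eq_iff eq ne)
  have 2: "\<not> E s (b i)" if "i \<le> Suc n" for i
    unfolding adj[OF in_set(1) mem[OF that]] using that sc by (auto simp: doubleton_eq_iff eq ne)
  have 3: "E s c\<^sub>1" "E s c\<^sub>2"
    unfolding adj[OF in_set(1,2)] adj[OF in_set(1,3)] by auto
  have 4: "E c\<^sub>1 (b i)" "E c\<^sub>2 (b i)" if "1 \<le> i" "i \<le> n" for i
    unfolding adj[OF in_set(2) mem[OF le_SucI[OF that(2)]]] adj[OF in_set(3) mem[OF le_SucI[OF that(2)]]]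
    using that by blast+
  have 5: "\<not> E c\<^sub>1 (b (Suc n))"
    unfolding adj[OF in_set(2) mem[OF order_refl]] using sc by (auto simp: doubleton_eq_iff eq ne)
  have 6: "\<not> E c\<^sub>2 (b 0)"
    unfolding adj[OF in_set(3) mem[OF le0]] using sc by (auto simp: doubleton_eq_iff eq ne)
  have "aw s c\<^sub>1 c\<^sub>2 b n"
    using 1 2 3 4 5 6 eq d by (auto simp: aw_def inj_on_def n_def)
  then show ?thesis
    unfolding b_def n_def .
qed

end

section \<open>Passing from reduced digraphs to the locale\<close>

lemma dominates_induce_subgraph: "u \<rightarrow>\<^bsub>G \<restriction> X\<^esub> v \<longleftrightarrow> u \<in> X \<and> v \<in> X \<and> u \<rightarrow>\<^bsub>G\<^esub> v"
  by (auto simp: arcs_ends_conv induce_subgraph_def)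

lemma has_edges_induce_subgraph:
  assumes "has_edges (G \<restriction> X) T" "u \<in> X" "v \<in> X"
  shows "u \<rightarrow>\<^bsub>G\<^esub> v \<longleftrightarrow> {u, v} \<in> T"
  using assms unfolding has_edges_def dominates_induce_subgraph by blast

text \<open>By induction all proper subsets induce interval graphs, so a failure at \<open>X\<close>
  would make \<open>X\<close> a minimal forbidden set of at most ten vertices.\<close>

lemma prereduced_small_interval:
  assumes "prereduced G" "finite X" "X \<subseteq> verts G" "card X \<le> 10"
  shows "interval_graph (G \<restriction> X)"
  using assms(2-4)
proof (induction X rule: finite_psubset_induct)
  case (psubset X)
  have "interval_graph (G \<restriction> Y)" if "Y \<subset> X" for Y
    using psubset.IH[OF that] psubset.prems psubset.hyps card_mono[of X Y] psubset_imp_subset[OF that]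
    by (meson order_trans)
  then show ?case
    using assms(1) psubset.prems unfolding prereduced_def minimal_forbidden_set_def by blast
qed

lemma interval_graph_induce_subgraph:
  assumes "interval_graph (G \<restriction> X)"
  shows "\<exists>lo hi. interval_model (\<lambda>u v. u \<rightarrow>\<^bsub>G\<^esub> v) X lo hi"
proof -
  obtain lo hi :: "'a \<Rightarrow> real" where "\<forall>v\<in>verts (G \<restriction> X). lo v \<le> hi v"
    "\<forall>u\<in>verts (G \<restriction> X). \<forall>v\<in>verts (G \<restriction> X). u \<noteq> v \<longrightarrow>
      (u \<rightarrow>\<^bsub>G \<restriction> X\<^esub> v \<longleftrightarrow> {lo u..hi u} \<inter> {lo v..hi v} \<noteq> {})"
    using assms unfolding interval_graph_def by blast
  then have "interval_model (\<lambda>u v. u \<rightarrow>\<^bsub>G\<^esub> v) X lo hi"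
    unfolding interval_model_def by (auto simp: dominates_induce_subgraph)
  then show ?thesis by blast
qed

lemma prereduced_locally_interval:
  assumes "graph G" "prereduced G"
  shows "locally_interval (verts G) (\<lambda>u v. u \<rightarrow>\<^bsub>G\<^esub> v)"
proof -
  interpret graph G by (rule assms(1))
  show ?thesis
  proof
    show "v \<rightarrow>\<^bsub>G\<^esub> u" if "u \<rightarrow>\<^bsub>G\<^esub> v" for u v
      by (rule arcs_ends_symmetric[OF sym_arcs that])
    show "\<not> v \<rightarrow>\<^bsub>G\<^esub> v" for v
      by (rule notI) (rule adj_not_same)
    show "u \<in> verts G" if "u \<rightarrow>\<^bsub>G\<^esub> v" for u v
      using that by (rule adj_in_verts)
    show "\<exists>lo hi. interval_model (\<lambda>u v. u \<rightarrow>\<^bsub>G\<^esub> v) X lo hi"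
      if "X \<subseteq> verts G" "finite X" "card X \<le> 10" for X
      using that assms(2) by (intro interval_graph_induce_subgraph prereduced_small_interval)
  qed
qed

theorem theorem2p1:
  fixes G :: "('a, 'b) pre_digraph"
  assumes "graph G"
    and "reduced G"
  shows "\<forall>s. shallow_terminal G s \<longrightarrow> simplicial G s"
proof (intro allI impI)
  fix s
  assume "shallow_terminal G s"
  interpret graph G by (rule assms(1))
  interpret L: locally_interval "verts G" "\<lambda>u v. u \<rightarrow>\<^bsub>G\<^esub> v"
    by (rule prereduced_locally_interval[OF assms(1)]) (rule assms(2)[unfolded reduced_def, THEN conjunct1])
  obtain X where "X \<subseteq> verts G" and X:
    "(\<exists>c l B r. dagger_AW (G \<restriction> X) s c l B r) \<or> (\<exists>c\<^sub>1 c\<^sub>2 l B r. ddagger_AW (G \<restriction> X) s c\<^sub>1 c\<^sub>2 l B r)"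
    using \<open>shallow_terminal G s\<close> unfolding shallow_terminal_def by (elim exE conjE) (rule that)
  from X obtain c\<^sub>1 c\<^sub>2 b d where aw: "L.aw s c\<^sub>1 c\<^sub>2 b d"
  proof (elim disjE exE)
    fix c l B r
    assume "dagger_AW (G \<restriction> X) s c l B r"
    note * = this[unfolded dagger_AW_def Let_def induce_subgraph_verts]
    \<comment> \<open>The first part of \<open>**\<close> equates \<open>X\<close> with the set of
      listed vertices; rewriting with it fits the edge condition to the premise on
      \<open>edges\<close>.\<close>
    note ** = *[THEN conjunct2, THEN conjunct2]
    show ?thesis
      by (rule that, rule L.aw_of_dagger[OF *[THEN conjunct1] *[THEN conjunct2, THEN conjunct1]],
          rule has_edges_induce_subgraph[OF **[THEN conjunct2, unfolded **[THEN conjunct1]]])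
  next
    fix c\<^sub>1 c\<^sub>2 l B r
    assume "ddagger_AW (G \<restriction> X) s c\<^sub>1 c\<^sub>2 l B r"
    note * = this[unfolded ddagger_AW_def Let_def induce_subgraph_verts]
    note ** = *[THEN conjunct2, THEN conjunct2]
    show ?thesis
      by (rule that, rule L.aw_of_double_dagger[OF *[THEN conjunct1] *[THEN conjunct2, THEN conjunct1]],
          rule has_edges_induce_subgraph[OF **[THEN conjunct2, unfolded **[THEN conjunct1]]])
  qed
  have nbh: "neighborhood G v = {w. v \<rightarrow>\<^bsub>G\<^esub> w}" for v
    by (auto simp: neighborhood_def)
  have modules: "\<forall>u\<in>M. \<forall>v\<in>M. u \<noteq> v \<longrightarrow> u \<rightarrow>\<^bsub>G\<^esub> v"
    if "M \<subseteq> verts G" "\<forall>u\<in>M. \<forall>v\<in>M. {w. u \<rightarrow>\<^bsub>G\<^esub> w} - M = {w. v \<rightarrow>\<^bsub>G\<^esub> w} - M"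
      "1 < card M" "card M < card (verts G)" for M
    using assms(2) that
    unfolding reduced_def nontrivial_module_def graph_module_def induces_clique_def nbh by blast
  show "simplicial G s"
    unfolding simplicial_def induces_clique_def nbh
    using L.aw_simplicial[OF finite_verts modules aw] L.adj_in L.aw_center(1)[OF aw] by blast
qed

end
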